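(* Let $G$ be a simple connected graph with $n\ge 2$ vertices. Then $$\frac{\Phi(G)^2}{2\Delta(G)}+\min_{u\in V(G)}\{\operatorname{trs}(u)-\deg(u)\}\ <\ \lambda_2(A^{\operatorname{trs}})\ \le\ 2\Phi(G)+\max_{u\in V(G)}\{\operatorname{trs}(u)-\deg(u)\}.$$
   Context: $\deg(u)$ is the degree of $u$, $\Delta(G)$ is the largest degree of a vertex of $G$, and $\operatorname{trs}(u)=\sum_{v\in V(G)}\operatorname{dist}(u,v)$ is the transmission of $u$, where $\operatorname{dist}(u,v)$ is the number of edges in a shortest path between $u$ and $v$. $A^{\operatorname{trs}}=\operatorname{trs}(G)-A(G)$, where $A(G)$ is the adjacency matrix and $\operatorname{trs}(G)$ the diagonal matrix of transmissions. For a real symmetric $n\times n$ matrix $M$, $\lambda_1(M)\le\lambda_2(M)\le\cdots\le\lambda_n(M)$ denote its eigenvalues. For $S\subseteq V(G)$, the edge-boundary is $\partial S=\{\{u,v\}\in E(G): u\in S,\ v\in V(G)\setminus S\}$, and the conductance of $G$ is $\Phi(G)=\min\{|\partial S|/|S| : \emptyset\ne S\subseteq V(G),\ |S|\le n/2\}$. *)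

theory Defs
  imports "HOL-Analysis.Analysis" "HOL-Computational_Algebra.Polynomial"
begin

text \<open>
  A graph has as its vertex set the whole finite type \<open>'v\<close>, so that matrices indexed by the
  vertices have type \<open>real ^ 'v ^ 'v\<close>. It is given by its set of edges, which are
  two-element sets of vertices.
\<close>

definition simple_graph :: "'v::finite set set \<Rightarrow> bool" where
  "simple_graph E \<longleftrightarrow> (\<forall>e\<in>E. card e = 2)"

text \<open>A path is the nonempty list of its pairwise distinct vertices; it has \<open>length p - 1\<close> edges.\<close>

definition graph_path :: "'v::finite set set \<Rightarrow> 'v \<Rightarrow> 'v list \<Rightarrow> 'v \<Rightarrow> bool" where
  "graph_path E u p v \<longleftrightarrow>
     p \<noteq> [] \<and> hd p = u \<and> last p = v \<and> distinct p \<and>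
     (\<forall>i. Suc i < length p \<longrightarrow> {p ! i, p ! Suc i} \<in> E)"

definition graph_connected :: "'v::finite set set \<Rightarrow> bool" where
  "graph_connected E \<longleftrightarrow> (\<forall>u v. \<exists>p. graph_path E u p v)"

definition graph_dist :: "'v::finite set set \<Rightarrow> 'v \<Rightarrow> 'v \<Rightarrow> nat" where
  "graph_dist E u v = (LEAST k. \<exists>p. graph_path E u p v \<and> k = length p - 1)"

definition degree_of :: "'v::finite set set \<Rightarrow> 'v \<Rightarrow> nat" where
  "degree_of E u = card {v. {u, v} \<in> E}"

definition max_degree :: "'v::finite set set \<Rightarrow> nat" where
  "max_degree E = Max (range (degree_of E))"

definition transmission :: "'v::finite set set \<Rightarrow> 'v \<Rightarrow> nat" where
  "transmission E u = (\<Sum>v\<in>UNIV. graph_dist E u v)"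

definition edge_boundary :: "'v::finite set set \<Rightarrow> 'v set \<Rightarrow> 'v set set" where
  "edge_boundary E S = {{u, v} | u v. {u, v} \<in> E \<and> u \<in> S \<and> v \<in> UNIV - S}"

definition conductance :: "'v::finite set set \<Rightarrow> real" where
  "conductance E =
     Min {real (card (edge_boundary E S)) / real (card S) | S.
            S \<noteq> {} \<and> real (card S) \<le> real CARD('v) / 2}"

definition adjacency_matrix :: "'v::finite set set \<Rightarrow> real ^ 'v ^ 'v" where
  "adjacency_matrix E = (\<chi> u v. if {u, v} \<in> E then 1 else 0)"

definition transmission_matrix :: "'v::finite set set \<Rightarrow> real ^ 'v ^ 'v" where
  "transmission_matrix E = (\<chi> u v. if u = v then real (transmission E u) else 0)"

definition A_trs :: "'v::finite set set \<Rightarrow> real ^ 'v ^ 'v" where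
  "A_trs E = transmission_matrix E - adjacency_matrix E"

definition charpoly :: "real ^ 'n ^ 'n \<Rightarrow> real poly" where
  "charpoly M = det (mat [:0, 1:] - (\<chi> i j. [:M $ i $ j:]))"

text \<open>
  \<open>eigval k M\<close> is the \<open>k\<close>-th smallest eigenvalue, counted from \<open>1\<close> and with multiplicity.
  The eigenvalues are the real roots of the characteristic polynomial, so this is meaningful
  for symmetric \<open>M\<close>, where all roots are real, and \<open>1 \<le> k \<le> CARD('n)\<close>.
\<close>

definition eigval :: "nat \<Rightarrow> real ^ 'n ^ 'n \<Rightarrow> real" where
  "eigval k M = sorted_list_of_multiset (proots (charpoly M)) ! (k - 1)"

lemma poly_charpoly: "poly (charpoly M) x = det (mat x - M)"
  unfolding charpoly_def det_def
  by (simp add: poly_sum poly_prod mat_def sign_def if_distrib [of "\<lambda>p. poly p x"] cong: if_cong)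

lemma poly_charpoly_eq_0_iff:
  "poly (charpoly M) x = 0 \<longleftrightarrow> (\<exists>v. v \<noteq> 0 \<and> M *v v = x *\<^sub>R v)"
proof -
  have "(mat x - M) *v v = x *\<^sub>R v - M *v v" for v
    by (simp add: matrix_vector_mult_diff_rdistrib mat_def matrix_vector_mult_def vec_eq_iff
        if_distrib [of "\<lambda>a. a * _"] sum_subtractf left_diff_distrib cong: if_cong)
  moreover have "det (mat x - M) = 0 \<longleftrightarrow> (\<exists>v. v \<noteq> 0 \<and> (mat x - M) *v v = 0)"
    using invertible_det_nz [of "mat x - M"] matrix_left_invertible_ker [of "mat x - M"]
      invertible_left_inverse [of "mat x - M"] by metis
  ultimately show ?thesis
    unfolding poly_charpoly by auto
qed

lemma transpose_A_trs: "transpose (A_trs E) = A_trs E"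
  by (auto simp: A_trs_def transmission_matrix_def adjacency_matrix_def transpose_def
      vec_eq_iff insert_commute)

end

theory Submission
  imports Defs
begin

text \<open>
  Let \<open>L\<close> be the Laplacian of the graph. Then \<open>A_trs\<close> is \<open>L\<close> plus the diagonal matrix with
  entries \<open>trs(u) - deg(u)\<close>, so its quadratic form at \<open>x\<close> is the Dirichlet energy
  \<open>\<Sum> (x\<^sub>u - x\<^sub>v)\<^sup>2\<close> over the edges plus a term lying between the minimum and the maximum of
  \<open>trs(u) - deg(u)\<close> times \<open>\<bar>x\<bar>\<^sup>2\<close> (\<open>A_trs_quadratic_form\<close>). What remains is the Cheeger inequality
  for the energy, in both directions.

  The second eigenvalue enters through a small part of the min-max principle. By the spectral
  theorem, proved here by maximizing the quadratic form over spheres, the characteristic polynomial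
  splits over an orthonormal eigenbasis. Hence the form is at most \<open>\<lambda>\<^sub>2 \<bar>x\<bar>\<^sup>2\<close> on the span of two
  eigenvectors and at least \<open>\<lambda>\<^sub>2 \<bar>x\<bar>\<^sup>2\<close> on the orthogonal complement of one
  (\<open>eigval_2_symmetric\<close>). Any plane contains a nonzero vector of that complement, which gives
  upper bounds for \<open>\<lambda>\<^sub>2\<close>, and the span of the two eigenvectors contains a nonzero vector of mean zero,
  which gives lower bounds.

  Upper bound: let \<open>S\<close> attain the conductance \<open>\<Phi>\<close>, and take the plane of the vectors that equal some
  \<open>p\<close> on \<open>S\<close> and some \<open>q\<close> elsewhere. Their energy is \<open>\<bar>\<partial>S\<bar> (p - q)\<^sup>2 \<le> 2 \<Phi> \<bar>S\<bar> (p\<^sup>2 + q\<^sup>2)\<close>, and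
  \<open>\<bar>S\<bar> (p\<^sup>2 + q\<^sup>2) \<le> \<bar>x\<bar>\<^sup>2\<close> because \<open>S\<close> is not larger than its complement.

  Lower bound: it suffices that every nonzero \<open>x\<close> of mean zero has energy greater than
  \<open>\<Phi>\<^sup>2 / (2 \<Delta>) \<bar>x\<bar>\<^sup>2\<close> (\<open>cheeger_inequality\<close>). Subtracting a median keeps the energy and does not
  decrease the norm, and afterwards the positive and negative parts, whose energies add up to at most
  that of \<open>x\<close>, each live on at most half of the vertices. For such a part \<open>g\<close> the coarea inequality
  bounds \<open>\<Sum> \<bar>g\<^sub>u\<^sup>2 - g\<^sub>v\<^sup>2\<bar>\<close> from below by \<open>\<Phi> \<bar>g\<bar>\<^sup>2\<close>, and Cauchy-Schwarz then gives
  \<open>(\<Phi> \<bar>g\<bar>\<^sup>2)\<^sup>2 \<le> e (2 \<Delta> \<bar>g\<bar>\<^sup>2 - e)\<close> for the energy \<open>e\<close> of \<open>g\<close>. The term \<open>- e\<^sup>2\<close> is what makes the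
  inequality strict: connectedness gives \<open>\<Phi> > 0\<close>, hence \<open>e > 0\<close> when \<open>g \<noteq> 0\<close>.
\<close>

section \<open>The spectral theorem for real symmetric matrices\<close>

lemma symmetric_matrix_inner:
  fixes M :: "real ^ 'n ^ 'n"
  assumes "transpose M = M"
  shows "x \<bullet> (M *v y) = (M *v x) \<bullet> y"
  by (metis assms dot_lmul_matrix vector_transpose_matrix)

text \<open>
  The quadratic form attains its maximum over the unit sphere of \<open>W\<close>, which is compact. A maximizer
  \<open>v\<close> with maximum \<open>m\<close> is an eigenvector: the residual \<open>m v - M v\<close> lies in \<open>W\<close>, as \<open>W\<close> is invariant,
  and if it were not zero, a small step along it would beat the maximum.
\<close>

lemma eigenvector_in_invariant_subspace:
  fixes M :: "real ^ 'n ^ 'n"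
  assumes sym: "transpose M = M" and W: "subspace W" and inv: "\<And>x. x \<in> W \<Longrightarrow> M *v x \<in> W"
    and nz: "z \<in> W" "z \<noteq> 0"
  obtains v c where "v \<in> W" "norm v = 1" "M *v v = c *\<^sub>R v"
proof -
  define K where "K = sphere 0 1 \<inter> W"
  have "compact K"
    unfolding K_def using W by (intro compact_Int_closed compact_sphere closed_subspace)
  moreover have "z /\<^sub>R norm z \<in> K"
    using nz W by (auto simp: K_def subspace_scale)
  moreover have "continuous_on K (\<lambda>x. x \<bullet> (M *v x))"
    by (intro continuous_intros)
  ultimately obtain v where v: "v \<in> K" and vmax: "\<And>x. x \<in> K \<Longrightarrow> x \<bullet> (M *v x) \<le> v \<bullet> (M *v v)"
    by (metis continuous_attains_sup empty_iff)
  define m where "m = v \<bullet> (M *v v)"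
  define w where "w = m *\<^sub>R v - M *v v"
  have vW: "v \<in> W" and vn: "norm v = 1"
    using v by (auto simp: K_def)
  have wW: "w \<in> W"
    unfolding w_def using vW W inv by (simp add: subspace_diff subspace_scale)
  have q: "x \<bullet> (M *v x) \<le> m * (x \<bullet> x)" if "x \<in> W" for x
  proof (cases "x = 0")
    case False
    then have "x /\<^sub>R norm x \<in> K"
      using that W by (auto simp: K_def subspace_scale)
    from vmax[OF this] have "(x \<bullet> (M *v x)) / (norm x * norm x) \<le> m"
      by (simp add: m_def matrix_vector_mult_scaleR divide_inverse mult_ac)
    then show ?thesis
      using False by (simp add: divide_le_eq dot_square_norm power2_eq_square)
  qed simp
  \<comment> \<open>The form \<open>m \<bar>x\<bar>\<^sup>2 - x \<bullet> M x\<close> is nonnegative on \<open>W\<close>; along \<open>w\<close> its slope at its zero \<open>v\<close> is \<open>2 \<bar>w\<bar>\<^sup>2\<close>.\<close>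
  have line: "0 \<le> 2 * t * (w \<bullet> w) + t\<^sup>2 * (m * (w \<bullet> w) - w \<bullet> (M *v w))" for t
  proof -
    have "v + t *\<^sub>R w \<in> W"
      using vW wW W by (simp add: subspace_add subspace_scale)
    from q[OF this]
    have "0 \<le> m * ((v + t *\<^sub>R w) \<bullet> (v + t *\<^sub>R w)) - (v + t *\<^sub>R w) \<bullet> (M *v (v + t *\<^sub>R w))"
      by simp
    also have "\<dots> = m * (v \<bullet> v) - v \<bullet> (M *v v) + 2 * t * (w \<bullet> (m *\<^sub>R v - M *v v))
        + t\<^sup>2 * (m * (w \<bullet> w) - w \<bullet> (M *v w))"
      using symmetric_matrix_inner[OF sym, of v w]
      by (simp add: matrix_vector_right_distrib matrix_vector_mult_scaleR inner_add_left
          inner_add_right inner_diff_right inner_commute power2_eq_square algebra_simps)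
    also have "m * (v \<bullet> v) - v \<bullet> (M *v v) = 0"
      using vn by (simp add: m_def dot_square_norm)
    finally show ?thesis
      by (simp add: w_def)
  qed
  have "w \<bullet> w = 0"
  proof (rule ccontr)
    assume ne: "w \<bullet> w \<noteq> 0"
    define a where "a = w \<bullet> w"
    define b where "b = \<bar>m * (w \<bullet> w) - w \<bullet> (M *v w)\<bar> + 1"
    have a: "a > 0" and b: "b > 0"
      using ne by (auto simp: a_def b_def)
    \<comment> \<open>With \<open>t = - a / b\<close> the linear term outweighs the quadratic one, whose coefficient is below \<open>b\<close>.\<close>
    have "0 \<le> 2 * (- (a / b)) * a + (- (a / b))\<^sup>2 * (m * (w \<bullet> w) - w \<bullet> (M *v w))"
      using line[of "- (a / b)"] by (simp add: a_def)
    also have "\<dots> \<le> 2 * (- (a / b)) * a + (- (a / b))\<^sup>2 * b"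
      by (intro add_left_mono mult_left_mono) (auto simp: b_def)
    also have "\<dots> = - (a * a / b)"
      using b by (simp add: power2_eq_square field_simps)
    finally show False
      using a b by (smt (verit) divide_pos_pos mult_pos_pos)
  qed
  then have "M *v v = m *\<^sub>R v"
    by (simp add: w_def)
  with vW vn that show ?thesis
    by blast
qed

text \<open>
  The orthogonal complement of a set of eigenvectors is invariant, because the matrix is symmetric,
  so it contains a further eigenvector as long as the set has fewer than \<open>n\<close> elements.
\<close>

lemma symmetric_matrix_orthonormal_eigenvectors:
  fixes M :: "real ^ 'n ^ 'n"
  assumes sym: "transpose M = M" and "k \<le> CARD('n)"
  shows "\<exists>B. finite B \<and> card B = k \<and> pairwise orthogonal B \<and>
    (\<forall>b\<in>B. norm b = 1 \<and> (\<exists>c. M *v b = c *\<^sub>R b))"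
  using \<open>k \<le> CARD('n)\<close>
proof (induction k)
  case 0
  then show ?case
    by (intro exI[of _ "{}"]) auto
next
  case (Suc k)
  then obtain B where B: "finite B" "card B = k" "pairwise orthogonal B"
    "\<And>b. b \<in> B \<Longrightarrow> norm b = 1" "\<And>b. b \<in> B \<Longrightarrow> \<exists>c. M *v b = c *\<^sub>R b"
    by auto
  define W where "W = {x. \<forall>b\<in>B. orthogonal b x}"
  have "dim (span B) < DIM(real ^ 'n)"
    using dim_le_card[OF _ B(1), of "span B"] B(2) Suc.prems by simp
  then obtain z where "z \<noteq> 0" "\<And>y. y \<in> span B \<Longrightarrow> orthogonal z y"
    using orthogonal_to_subspace_exists[of "span B"] by (metis dim_span span_span)
  then have z: "z \<in> W" "z \<noteq> 0"
    by (auto simp: W_def orthogonal_commute span_base)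
  have W: "subspace W"
    by (auto simp: W_def subspace_def orthogonal_def inner_add_right)
  have inv: "M *v x \<in> W" if "x \<in> W" for x
    unfolding W_def
  proof safe
    fix b assume b: "b \<in> B"
    then obtain c where "M *v b = c *\<^sub>R b"
      using B(5) by blast
    then show "orthogonal b (M *v x)"
      using that b symmetric_matrix_inner[OF sym, of b x] by (simp add: W_def orthogonal_def)
  qed
  obtain v c where v: "v \<in> W" "norm v = 1" "M *v v = c *\<^sub>R v"
    using eigenvector_in_invariant_subspace[OF sym W inv z] by blast
  have "v \<notin> B"
    using v(1,2) by (auto simp: W_def orthogonal_def)
  then show ?case
    using B v by (intro exI[of _ "insert v B"])
      (auto simp: pairwise_insert W_def orthogonal_commute)
qed

theorem symmetric_matrix_spectral:
  fixes M :: "real ^ 'n ^ 'n"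
  assumes sym: "transpose M = M"
  obtains b :: "'n \<Rightarrow> real ^ 'n" and l :: "'n \<Rightarrow> real"
  where "\<And>i j. b i \<bullet> b j = (if i = j then 1 else 0)" "\<And>i. M *v b i = l i *\<^sub>R b i"
proof -
  obtain B where B: "finite B" "card B = CARD('n)" "pairwise orthogonal B"
    "\<forall>b\<in>B. norm b = 1 \<and> (\<exists>c. M *v b = c *\<^sub>R b)"
    using symmetric_matrix_orthonormal_eigenvectors[OF sym, of "CARD('n)"] by auto
  obtain b where b: "bij_betw b (UNIV :: 'n set) B"
    using finite_same_card_bij[of "UNIV :: 'n set" B] B by auto
  have bB: "b i \<in> B" for i
    using b by (auto simp: bij_betw_def)
  have "\<forall>i. \<exists>c. M *v b i = c *\<^sub>R b i"
    using B(4) bB by blast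
  then obtain l where l: "\<And>i. M *v b i = l i *\<^sub>R b i"
    by metis
  have "b i \<bullet> b j = (if i = j then 1 else 0)" for i j
  proof (cases "i = j")
    case True
    then show ?thesis
      using B(4) bB[of j] by (simp add: dot_square_norm)
  next
    case False
    then have "b i \<noteq> b j"
      using b by (auto simp: bij_betw_def inj_on_def)
    then show ?thesis
      using B(3) bB False by (auto simp: pairwise_def orthogonal_def)
  qed
  with l that show ?thesis
    by blast
qed

text \<open>
  The matrix \<open>P\<close> with the columns \<open>b j\<close> diagonalizes \<open>M\<close>. Comparing determinants at every real \<open>x\<close>
  identifies the polynomials without any computation with matrices of polynomials.
\<close>

lemma charpoly_symmetric:
  fixes M :: "real ^ 'n ^ 'n" and b :: "'n \<Rightarrow> real ^ 'n"
  assumes on: "\<And>i j. b i \<bullet> b j = (if i = j then 1 else 0)"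
    and ev: "\<And>i. M *v b i = l i *\<^sub>R b i"
  shows "charpoly M = (\<Prod>i\<in>UNIV. [:- l i, 1:])"
proof -
  define P where "P = (\<chi> i j. b j $ i)"
  define D where "D x = (\<chi> i j. if i = j then x - l i else 0)" for x :: real
  have PP: "transpose P ** P = mat 1"
    using on by (simp add: vec_eq_iff matrix_matrix_mult_def transpose_def P_def mat_def inner_vec_def)
  have entry: "(\<Sum>k\<in>UNIV. M $ i $ k * b j $ k) = l j * b j $ i" for i j
    using ev[of j] by (simp add: vec_eq_iff matrix_vector_mult_def)
  have MP: "(mat x - M) ** P = P ** D x" for x
    by (auto simp: vec_eq_iff matrix_matrix_mult_def P_def mat_def D_def left_diff_distrib
        right_diff_distrib sum_subtractf entry if_distrib[of "\<lambda>a. a * _"]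
        if_distrib[of "\<lambda>a. _ * a"] mult.commute[of x] mult.commute[of "l _"] cong: if_cong)
  have dP: "det P * det P = 1"
    using arg_cong[OF PP, of det] by (simp add: det_mul)
  have "det (mat x - M) = det (D x)" for x
  proof -
    have "det (mat x - M) * det P = det P * det (D x)"
      using arg_cong[OF MP, of det] by (simp add: det_mul)
    then show ?thesis
      using dP by (metis mult.commute mult_cancel_left mult_zero_left zero_neq_one)
  qed
  moreover have "det (D x) = (\<Prod>i\<in>UNIV. x - l i)" for x
    by (subst det_diagonal) (auto simp: D_def)
  ultimately have "poly (charpoly M) = poly (\<Prod>i\<in>UNIV. [:- l i, 1:])"
    by (auto simp: poly_charpoly poly_prod)
  then show ?thesis
    by (simp add: poly_eq_poly_eq_iff)
qed

section \<open>Variational bounds for the second eigenvalue\<close>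

text \<open>
  Sorting with multiplicity is replaced by two indices: \<open>i\<close> minimizes \<open>l\<close> and \<open>j\<close> minimizes it among
  the other indices, so repeated values need no separate treatment.
\<close>

lemma second_smallest_value:
  fixes l :: "'n::finite \<Rightarrow> real"
  assumes "CARD('n) \<ge> 2"
  obtains i j where "i \<noteq> j" "l i \<le> l j" "\<And>k. k \<noteq> i \<Longrightarrow> l j \<le> l k"
    "sorted_list_of_multiset (image_mset l (mset_set UNIV)) ! 1 = l j"
proof -
  define i where "i = arg_min_on l UNIV"
  have i: "l i \<le> l k" for k
    unfolding i_def by (rule arg_min_least) auto
  have "UNIV - {i} \<noteq> {}"
  proof
    assume "UNIV - {i} = {}"
    then have "UNIV = {i}" by auto
    then have "CARD('n) = card {i}" by metis
    then show False using assms by simp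
  qed
  then have "arg_min_on l (UNIV - {i}) \<in> UNIV - {i}"
    and "\<And>k. k \<in> UNIV - {i} \<Longrightarrow> l (arg_min_on l (UNIV - {i})) \<le> l k"
    by (auto simp del: Diff_iff intro!: arg_min_if_finite(1) arg_min_least)
  then obtain j where j: "j \<noteq> i" "\<And>k. k \<noteq> i \<Longrightarrow> l j \<le> l k"
    by blast
  define R where "R = image_mset l (mset_set (UNIV - {i, j}))"
  define xs where "xs = l i # l j # sorted_list_of_multiset R"
  have "mset_set (UNIV :: 'n set) = mset_set (insert i (insert j (UNIV - {i, j})))"
    by (rule arg_cong[of _ _ mset_set]) auto
  also have "\<dots> = add_mset i (add_mset j (mset_set (UNIV - {i, j})))"
    using j(1) by simp
  finally have "mset_set (UNIV :: 'n set) = add_mset i (add_mset j (mset_set (UNIV - {i, j})))" .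
  then have "mset xs = image_mset l (mset_set UNIV)"
    by (simp add: xs_def R_def)
  moreover have "sorted xs"
    using i j by (auto simp: xs_def R_def)
  ultimately have "sorted_list_of_multiset (image_mset l (mset_set UNIV)) = xs"
    by (metis sort_key_id_if_sorted sorted_list_of_multiset_mset sorted_sort_id)
  then show ?thesis
    using that[of i j] i j by (auto simp: xs_def)
qed

text \<open>
  Expand in an eigenbasis. The eigenvalues of \<open>b1\<close> and \<open>b2\<close> are the two smallest ones, so neither
  exceeds \<open>eigval 2 M\<close>, and no basis vector other than \<open>b1\<close> has a smaller eigenvalue than that.
\<close>

theorem eigval_2_symmetric:
  fixes M :: "real ^ 'n ^ 'n"
  assumes sym: "transpose M = M" and card: "CARD('n) \<ge> 2"
  obtains b1 b2 :: "real ^ 'n" where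
    "norm b1 = 1" "norm b2 = 1" "b1 \<bullet> b2 = 0"
    "\<And>s t. (s *\<^sub>R b1 + t *\<^sub>R b2) \<bullet> (M *v (s *\<^sub>R b1 + t *\<^sub>R b2)) \<le> eigval 2 M * (s\<^sup>2 + t\<^sup>2)"
    "\<And>x. b1 \<bullet> x = 0 \<Longrightarrow> eigval 2 M * (x \<bullet> x) \<le> x \<bullet> (M *v x)"
proof -
  obtain b :: "'n \<Rightarrow> real ^ 'n" and l where
    on: "\<And>i j. b i \<bullet> b j = (if i = j then 1 else 0)" and ev: "\<And>i. M *v b i = l i *\<^sub>R b i"
    using symmetric_matrix_spectral[OF sym] by blast
  obtain i j where ij: "i \<noteq> j" "l i \<le> l j" "\<And>k. k \<noteq> i \<Longrightarrow> l j \<le> l k"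
    "sorted_list_of_multiset (image_mset l (mset_set UNIV)) ! 1 = l j"
    using second_smallest_value[OF card] by blast
  have "proots (charpoly M) = image_mset l (mset_set UNIV)"
    unfolding charpoly_symmetric[OF on ev]
    by (subst proots_prod) (auto simp: sum_unfold_sum_mset)
  then have eig: "eigval 2 M = l j"
    using ij(4) by (simp add: eigval_def)
  have inj: "inj b"
    by (rule injI) (metis on zero_neq_one)
  \<comment> \<open>The remainder is orthogonal to a basis and hence to itself.\<close>
  have expand: "x = (\<Sum>k\<in>UNIV. (b k \<bullet> x) *\<^sub>R b k)" for x
  proof -
    define y where "y = x - (\<Sum>k\<in>UNIV. (b k \<bullet> x) *\<^sub>R b k)"
    have orth: "b k \<bullet> y = 0" for k
      by (simp add: y_def inner_diff_right inner_sum_right on if_distrib cong: if_cong)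
    have "independent (range b)"
      by (rule pairwise_orthogonal_independent)
        (auto simp: pairwise_def orthogonal_def on, metis inner_zero_left on zero_neq_one)
    then have "span (range b) = UNIV"
      using inj by (intro dim_eq_full[THEN iffD1]) (simp add: dim_eq_card_independent card_image)
    moreover have "orthogonal y z" if "z \<in> span (range b)" for z
      using that by (rule orthogonal_to_span) (auto simp: orthogonal_def orth inner_commute[of y])
    ultimately have "y \<bullet> y = 0"
      by (simp add: orthogonal_def)
    then show ?thesis
      by (simp add: y_def)
  qed
  have sq: "x \<bullet> z = (\<Sum>k\<in>UNIV. (b k \<bullet> x) * (b k \<bullet> z))" for x z
    by (subst expand[of x]) (simp add: inner_sum_left)
  show ?thesis
  proof (rule that[of "b i" "b j"])
    fix s t :: real
    have "(s *\<^sub>R b i + t *\<^sub>R b j) \<bullet> (M *v (s *\<^sub>R b i + t *\<^sub>R b j)) = l i * s\<^sup>2 + l j * t\<^sup>2"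
      using ij(1) by (simp add: matrix_vector_right_distrib matrix_vector_mult_scaleR ev on
          inner_add_left inner_add_right power2_eq_square)
    also have "\<dots> \<le> l j * (s\<^sup>2 + t\<^sup>2)"
      using ij(2) by (simp add: distrib_left mult_right_mono)
    finally show "(s *\<^sub>R b i + t *\<^sub>R b j) \<bullet> (M *v (s *\<^sub>R b i + t *\<^sub>R b j)) \<le> eigval 2 M * (s\<^sup>2 + t\<^sup>2)"
      by (simp add: eig)
  next
    fix x assume x: "b i \<bullet> x = 0"
    have "b k \<bullet> (M *v x) = l k * (b k \<bullet> x)" for k
      using symmetric_matrix_inner[OF sym, of "b k" x] by (simp add: ev)
    then have "x \<bullet> (M *v x) = (\<Sum>k\<in>UNIV. l k * (b k \<bullet> x)\<^sup>2)"
      by (subst sq) (simp add: power2_eq_square mult_ac)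
    moreover have "l j * (b k \<bullet> x)\<^sup>2 \<le> l k * (b k \<bullet> x)\<^sup>2" for k
      by (cases "k = i") (auto simp: x ij(3) mult_right_mono)
    then have "(\<Sum>k\<in>UNIV. l j * (b k \<bullet> x)\<^sup>2) \<le> (\<Sum>k\<in>UNIV. l k * (b k \<bullet> x)\<^sup>2)"
      by (rule sum_mono)
    moreover have "l j * (x \<bullet> x) = (\<Sum>k\<in>UNIV. l j * (b k \<bullet> x)\<^sup>2)"
      by (subst sq) (simp add: sum_distrib_left power2_eq_square)
    ultimately show "eigval 2 M * (x \<bullet> x) \<le> x \<bullet> (M *v x)"
      by (simp add: eig)
  qed (use ij(1) on in \<open>auto simp: norm_eq_1\<close>)
qed

text \<open>
  The span of the two lowest eigenvectors contains a nonzero vector of mean zero, on which the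
  quadratic form is at most \<open>eigval 2 M\<close> times the squared norm.
\<close>

lemma eigval_2_witness_sum_zero:
  fixes M :: "real ^ 'n ^ 'n"
  assumes "transpose M = M" and "CARD('n) \<ge> 2"
  obtains x where "x \<noteq> 0" "(\<Sum>u\<in>UNIV. x $ u) = 0" "x \<bullet> (M *v x) \<le> eigval 2 M * (x \<bullet> x)"
proof -
  obtain b1 b2 :: "real ^ 'n" where b: "norm b1 = 1" "norm b2 = 1" "b1 \<bullet> b2 = 0"
    and le: "\<And>s t. (s *\<^sub>R b1 + t *\<^sub>R b2) \<bullet> (M *v (s *\<^sub>R b1 + t *\<^sub>R b2)) \<le> eigval 2 M * (s\<^sup>2 + t\<^sup>2)"
    using eigval_2_symmetric[OF assms] by metis
  define a1 where "a1 = (\<Sum>u\<in>UNIV. b1 $ u)"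
  define a2 where "a2 = (\<Sum>u\<in>UNIV. b2 $ u)"
  obtain s t where st: "s \<noteq> 0 \<or> t \<noteq> 0" "s * a1 + t * a2 = 0"
  proof (cases "a1 = 0 \<and> a2 = 0")
    case True
    then show ?thesis
      using that[of 1 0] by simp
  next
    case False
    then show ?thesis
      using that[of a2 "- a1"] by auto
  qed
  define x where "x = s *\<^sub>R b1 + t *\<^sub>R b2"
  have xx: "x \<bullet> x = s\<^sup>2 + t\<^sup>2"
    using b unfolding x_def norm_eq_1
    by (simp add: inner_add_left inner_add_right inner_commute[of b2 b1] power2_eq_square
        del: dot_square_norm)
  show ?thesis
  proof (rule that[of x])
    have "0 < s\<^sup>2 + t\<^sup>2"
      using st(1) by (simp add: sum_power2_gt_zero_iff)
    then show "x \<noteq> 0"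
      using xx by auto
    show "(\<Sum>u\<in>UNIV. x $ u) = 0"
      using st(2) by (simp add: x_def sum.distrib a1_def a2_def sum_distrib_left)
    show "x \<bullet> (M *v x) \<le> eigval 2 M * (x \<bullet> x)"
      unfolding xx unfolding x_def by (rule le)
  qed
qed

text \<open>
  Orthogonality to the lowest eigenvector is a single linear condition on the pair \<open>(p, q)\<close> and so
  has a nonzero solution.
\<close>

lemma eigval_2_witness_two_valued:
  fixes M :: "real ^ 'n ^ 'n"
  assumes "transpose M = M" and "CARD('n) \<ge> 2"
  obtains p q :: real where "p \<noteq> 0 \<or> q \<noteq> 0"
    "let x = (\<chi> u. if u \<in> S then p else q) in eigval 2 M * (x \<bullet> x) \<le> x \<bullet> (M *v x)"
proof -
  obtain b :: "real ^ 'n" where le: "\<And>x. b \<bullet> x = 0 \<Longrightarrow> eigval 2 M * (x \<bullet> x) \<le> x \<bullet> (M *v x)"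
    using eigval_2_symmetric[OF assms] by metis
  define a1 where "a1 = (\<Sum>u\<in>S. b $ u)"
  define a2 where "a2 = (\<Sum>u\<in>-S. b $ u)"
  have inner: "b \<bullet> (\<chi> u. if u \<in> S then p else q) = p * a1 + q * a2" for p q
    by (simp add: inner_vec_def if_distrib[of "\<lambda>c. _ * c"] sum.If_cases a1_def a2_def
        Compl_eq sum_distrib_left mult.commute cong: if_cong)
  show ?thesis
  proof (cases "a1 = 0 \<and> a2 = 0")
    case True
    then show ?thesis
      using that[of 1 1] le inner[of 1 1] by (simp add: Let_def)
  next
    case False
    then show ?thesis
      using that[of a2 "- a1"] le inner[of a2 "- a1"] by (auto simp: Let_def)
  qed
qed

section \<open>The quadratic form and the Dirichlet energy\<close>

text \<open>Every edge contributes both of its orientations.\<close>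

definition arcs :: "'v::finite set set \<Rightarrow> ('v \<times> 'v) set" where
  "arcs E = (SIGMA u : UNIV. {v. {u, v} \<in> E})"

text \<open>
  The Laplacian quadratic form; the division by two makes up for the two orientations of an edge.
\<close>

definition energy :: "'v::finite set set \<Rightarrow> ('v \<Rightarrow> real) \<Rightarrow> real" where
  "energy E x = (\<Sum>(u, v)\<in>arcs E. (x u - x v)\<^sup>2) / 2"

lemma sum_arcs_swap: "(\<Sum>(u, v)\<in>arcs E. f u v) = (\<Sum>(u, v)\<in>arcs E. f v u)"
  by (rule sum.reindex_bij_witness[of _ prod.swap prod.swap])
    (auto simp: arcs_def insert_commute)

lemma sum_arcs_tail: "(\<Sum>(u, v)\<in>arcs E. f u) = (\<Sum>u\<in>UNIV. real (degree_of E u) * f u)"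
  unfolding arcs_def degree_of_def by (subst sum.Sigma[symmetric]) auto

lemma sum_arcs_head: "(\<Sum>(u, v)\<in>arcs E. f v) = (\<Sum>u\<in>UNIV. real (degree_of E u) * f u)"
  using sum_arcs_swap[of "\<lambda>u v. f v" E] by (simp add: sum_arcs_tail)

lemma A_trs_quadratic_form:
  "x \<bullet> (A_trs E *v x) = (\<Sum>u\<in>UNIV. (real (transmission E u) - real (degree_of E u)) * (x $ u)\<^sup>2)
     + energy E (vec_nth x)"
proof -
  have adj: "x \<bullet> (adjacency_matrix E *v x) = (\<Sum>(u, v)\<in>arcs E. x $ u * x $ v)"
    unfolding arcs_def
    by (subst sum.Sigma[symmetric]) (auto simp: inner_vec_def matrix_vector_mult_def adjacency_matrix_def sum_distrib_left
        if_distrib[of "\<lambda>a. a * _"] sum.If_cases cong: if_cong)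
  have trs: "x \<bullet> (transmission_matrix E *v x) = (\<Sum>u\<in>UNIV. real (transmission E u) * (x $ u)\<^sup>2)"
    by (simp add: inner_vec_def matrix_vector_mult_def transmission_matrix_def
        if_distrib[of "\<lambda>a. a * _"] power2_eq_square mult.left_commute cong: if_cong)
  have "(\<Sum>(u, v)\<in>arcs E. (x $ u - x $ v)\<^sup>2)
      = (\<Sum>(u, v)\<in>arcs E. (x $ u)\<^sup>2) + (\<Sum>(u, v)\<in>arcs E. (x $ v)\<^sup>2) - 2 * (\<Sum>(u, v)\<in>arcs E. x $ u * x $ v)"
    by (simp add: sum_distrib_left sum.distrib[symmetric] sum_subtractf[symmetric] case_prod_beta power2_diff algebra_simps)
  then have "energy E (vec_nth x) = (\<Sum>u\<in>UNIV. real (degree_of E u) * (x $ u)\<^sup>2) - (\<Sum>(u, v)\<in>arcs E. x $ u * x $ v)"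
    by (simp add: energy_def sum_arcs_tail sum_arcs_head)
  then show ?thesis
    by (simp add: A_trs_def matrix_vector_mult_diff_rdistrib inner_diff_right adj trs
        left_diff_distrib sum_subtractf)
qed

lemma energy_nonneg: "0 \<le> energy E x"
  by (auto simp: energy_def intro!: sum_nonneg)

text \<open>An edge in the boundary is one arc leaving \<open>S\<close> and one arc entering it.\<close>

lemma sum_arcs_indicator:
  "(\<Sum>(u, v)\<in>arcs E. \<bar>indicator S u - indicator S v\<bar> :: real) = 2 * real (card (edge_boundary E S))"
proof -
  define A where "A = {(u, v). {u, v} \<in> E \<and> u \<in> S \<and> v \<notin> S}"
  have "bij_betw (\<lambda>(u, v). {u, v}) A (edge_boundary E S)"
    unfolding bij_betw_def A_def edge_boundary_def
    by (auto simp: inj_on_def doubleton_eq_iff image_iff)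
  then have card: "card A = card (edge_boundary E S)"
    by (rule bij_betw_same_card)
  have "(\<Sum>(u, v)\<in>arcs E. \<bar>indicator S u - indicator S v\<bar> :: real)
      = (\<Sum>(u, v)\<in>arcs E. of_bool (u \<in> S \<and> v \<notin> S) + of_bool (v \<in> S \<and> u \<notin> S))"
    by (intro sum.cong) (auto simp: indicator_def)
  also have "\<dots> = (\<Sum>(u, v)\<in>arcs E. of_bool (u \<in> S \<and> v \<notin> S)) + (\<Sum>(u, v)\<in>arcs E. of_bool (v \<in> S \<and> u \<notin> S))"
    by (simp add: case_prod_beta sum.distrib)
  also have "\<dots> = 2 * (\<Sum>(u, v)\<in>arcs E. of_bool (u \<in> S \<and> v \<notin> S))"
    by (subst (2) sum_arcs_swap) simp
  also have "(\<Sum>(u, v)\<in>arcs E. of_bool (u \<in> S \<and> v \<notin> S)) = (\<Sum>p\<in>A. 1 :: real)"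
    by (rule sum.mono_neutral_cong_right) (auto simp: A_def arcs_def)
  finally show ?thesis
    by (simp add: card)
qed

lemma energy_two_valued:
  "energy E (\<lambda>u. if u \<in> S then p else q) = real (card (edge_boundary E S)) * (p - q)\<^sup>2"
proof -
  have "(\<Sum>(u, v)\<in>arcs E. ((if u \<in> S then p else q) - (if v \<in> S then p else q))\<^sup>2)
      = (\<Sum>(u, v)\<in>arcs E. (p - q)\<^sup>2 * \<bar>indicator S u - indicator S v\<bar>)"
    by (intro sum.cong) (auto simp: power2_commute)
  also have "\<dots> = (p - q)\<^sup>2 * (2 * real (card (edge_boundary E S)))"
    unfolding sum_arcs_indicator[symmetric] by (simp add: sum_distrib_left case_prod_beta)
  finally show ?thesis
    by (simp add: energy_def)
qed

section \<open>Conductance\<close>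

lemma conductance_eq_Min:
  "conductance E = Min ((\<lambda>S. real (card (edge_boundary E S)) / real (card S)) `
     {S. S \<noteq> {} \<and> real (card S) \<le> real CARD('v) / 2})" for E :: "'v::finite set set"
  unfolding conductance_def by (rule arg_cong[of _ _ Min]) auto

lemma conductance_le:
  fixes E :: "'v::finite set set"
  assumes "real (card S) \<le> real CARD('v) / 2"
  shows "conductance E * real (card S) \<le> real (card (edge_boundary E S))"
proof (cases "S = {}")
  case False
  then have "conductance E \<le> real (card (edge_boundary E S)) / real (card S)"
    unfolding conductance_eq_Min using assms by (intro Min_le) auto
  then show ?thesis
    using False by (simp add: le_divide_eq card_gt_0_iff)
qed simp

lemma conductance_attained:
  fixes E :: "'v::finite set set"
  assumes "CARD('v) \<ge> 2"
  obtains S where "S \<noteq> {}" "real (card S) \<le> real CARD('v) / 2"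
    "real (card (edge_boundary E S)) = conductance E * real (card S)"
proof -
  let ?C = "{S :: 'v set. S \<noteq> {} \<and> real (card S) \<le> real CARD('v) / 2}"
  have "{undefined} \<in> ?C"
    using assms by simp
  then have "conductance E \<in> (\<lambda>S. real (card (edge_boundary E S)) / real (card S)) ` ?C"
    unfolding conductance_eq_Min by (intro Min_in) (auto simp del: mem_Collect_eq)
  then obtain S where "S \<in> ?C" "conductance E = real (card (edge_boundary E S)) / real (card S)"
    by blast
  then show ?thesis
    using that[of S] by simp
qed

text \<open>A path from \<open>S\<close> to its complement has to leave \<open>S\<close> along some edge.\<close>

lemma edge_boundary_nonempty:
  assumes conn: "graph_connected E" and S: "S \<noteq> {}" "S \<noteq> UNIV"
  shows "edge_boundary E S \<noteq> {}"
proof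
  assume empty: "edge_boundary E S = {}"
  obtain u v where u: "u \<in> S" and v: "v \<notin> S"
    using S by auto
  obtain p where p: "graph_path E u p v"
    using conn by (auto simp: graph_connected_def)
  have "p ! i \<in> S" if "i < length p" for i
    using that
  proof (induction i)
    case 0
    then show ?case
      using p u by (auto simp: graph_path_def hd_conv_nth)
  next
    case (Suc i)
    then have "{p ! i, p ! Suc i} \<in> E" "p ! i \<in> S"
      using p by (auto simp: graph_path_def)
    then show ?case
      using empty by (auto simp: edge_boundary_def)
  qed
  then have "last p \<in> S"
    using p last_conv_nth[of p] by (simp add: graph_path_def)
  then show False
    using p v by (simp add: graph_path_def)
qed

lemma conductance_pos:
  fixes E :: "'v::finite set set"
  assumes "graph_connected E" and "CARD('v) \<ge> 2"
  shows "0 < conductance E"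
proof -
  obtain S where S: "S \<noteq> {}" "real (card S) \<le> real CARD('v) / 2"
    "real (card (edge_boundary E S)) = conductance E * real (card S)"
    using conductance_attained[OF assms(2)] by blast
  have "S \<noteq> UNIV"
    using S(2) assms(2) by auto
  then have "0 < card (edge_boundary E S)"
    using edge_boundary_nonempty[OF assms(1) S(1)] by (simp add: card_gt_0_iff)
  then show ?thesis
    using S(3) by (metis of_nat_0_le_iff of_nat_0_less_iff zero_less_mult_pos2 mult_eq_0_iff not_gr_zero of_nat_eq_0_iff order_le_less)
qed

section \<open>The Cheeger inequality\<close>

text \<open>
  A layer-cake argument. With \<open>m\<close> the least nonzero value of \<open>F\<close> and \<open>S\<close> its support, subtracting
  \<open>m\<close> on \<open>S\<close> lowers the right-hand side by \<open>2 m \<bar>\<partial>S\<bar>\<close>, since exactly the boundary edges change,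
  and the left-hand side by \<open>2 \<Phi> m \<bar>S\<bar>\<close>, which is no more. The support shrinks, so induction applies.
  The factor two comes from summing over both orientations of the edges.
\<close>

lemma coarea_inequality:
  fixes F :: "'v::finite \<Rightarrow> real"
  assumes "\<And>u. 0 \<le> F u" and "real (card {u. F u \<noteq> 0}) \<le> real CARD('v) / 2"
  shows "2 * conductance E * (\<Sum>u\<in>UNIV. F u) \<le> (\<Sum>(u, v)\<in>arcs E. \<bar>F u - F v\<bar>)"
  using assms
proof (induction "card {u. F u \<noteq> 0}" arbitrary: F rule: less_induct)
  case less
  define S where "S = {u. F u \<noteq> 0}"
  show ?case
  proof (cases "S = {}")
    case True
    then show ?thesis
      by (simp add: S_def)
  next
    case False
    obtain w where w: "w \<in> S" "\<And>u. u \<in> S \<Longrightarrow> F w \<le> F u"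
      using arg_min_if_finite[of S F] False by (metis finite not_le)
    define G where "G u = F u - F w * indicator S u" for u
    have Gnn: "0 \<le> G u" for u
      using w less.prems(1)[of u] by (auto simp: G_def indicator_def)
    have "{u. G u \<noteq> 0} \<subset> S"
      using w(1) by (auto simp: G_def S_def indicator_def split: if_splits)
    then have smaller: "card {u. G u \<noteq> 0} < card S"
      by (simp add: psubset_card_mono)
    have IH: "2 * conductance E * (\<Sum>u\<in>UNIV. G u) \<le> (\<Sum>(u, v)\<in>arcs E. \<bar>G u - G v\<bar>)"
      using less.hyps[of G] smaller less.prems(2) Gnn by (simp add: S_def)
    have FG: "\<bar>F u - F v\<bar> = \<bar>G u - G v\<bar> + F w * \<bar>indicator S u - indicator S v\<bar>" for u v
      using w(2)[of u] w(2)[of v] less.prems(1)[of w]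
      by (cases "u \<in> S"; cases "v \<in> S") (auto simp: G_def S_def)
    have card_indicator: "(\<Sum>u\<in>UNIV. indicator S u) = real (card S)"
      by (simp add: indicator_def sum.If_cases)
    have "2 * conductance E * (\<Sum>u\<in>UNIV. F u)
        = 2 * conductance E * (\<Sum>u\<in>UNIV. G u) + 2 * F w * (conductance E * real (card S))"
      by (simp add: G_def sum_subtractf sum_distrib_left[symmetric] card_indicator algebra_simps)
    also have "\<dots> \<le> (\<Sum>(u, v)\<in>arcs E. \<bar>G u - G v\<bar>) + 2 * F w * real (card (edge_boundary E S))"
      using IH conductance_le[of S E] less.prems by (intro add_mono mult_left_mono) (auto simp: S_def)
    also have "\<dots> = (\<Sum>(u, v)\<in>arcs E. \<bar>F u - F v\<bar>)"
      using sum_arcs_indicator[of S E]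
      by (simp add: FG case_prod_beta sum.distrib sum_distrib_left[symmetric])
    finally show ?thesis .
  qed
qed

text \<open>
  Factor \<open>g\<^sub>u\<^sup>2 - g\<^sub>v\<^sup>2\<close> and apply the coarea inequality to \<open>g\<^sup>2\<close> and then Cauchy-Schwarz. Instead of
  bounding \<open>\<Sum> (g\<^sub>u + g\<^sub>v)\<^sup>2\<close> by \<open>2 \<Sum> (g\<^sub>u\<^sup>2 + g\<^sub>v\<^sup>2)\<close> alone, the parallelogram identity keeps
  the term \<open>- energy E g\<close>, on which the strictness of the Cheeger inequality rests.
\<close>

lemma cheeger_product_inequality:
  fixes g :: "'v::finite \<Rightarrow> real" and E :: "'v set set"
  assumes nn: "\<And>u. 0 \<le> g u" and supp: "real (card {u. g u \<noteq> 0}) \<le> real CARD('v) / 2"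
    and h: "0 \<le> conductance E"
  defines "Q \<equiv> \<Sum>u\<in>UNIV. (g u)\<^sup>2"
  shows "(conductance E * Q)\<^sup>2 \<le> energy E g * (2 * real (max_degree E) * Q - energy E g)"
proof -
  define P where "P = (\<Sum>(u, v)\<in>arcs E. (g u + g v)\<^sup>2)"
  have "2 * conductance E * Q \<le> (\<Sum>(u, v)\<in>arcs E. \<bar>(g u)\<^sup>2 - (g v)\<^sup>2\<bar>)"
    unfolding Q_def using nn supp by (intro coarea_inequality) auto
  also have "\<dots> = (\<Sum>(u, v)\<in>arcs E. \<bar>g u - g v\<bar> * (g u + g v))"
    using nn by (intro sum.cong)
      (auto simp: power2_eq_square square_diff_square_factored abs_mult mult_ac)
  finally have "(2 * conductance E * Q)\<^sup>2 \<le> (\<Sum>(u, v)\<in>arcs E. \<bar>g u - g v\<bar> * (g u + g v))\<^sup>2"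
    using h by (intro power_mono) (auto simp: Q_def sum_nonneg)
  also have "\<dots> \<le> (2 * energy E g) * P"
    using Cauchy_Schwarz_ineq_sum[of "\<lambda>p. \<bar>g (fst p) - g (snd p)\<bar>" "\<lambda>p. g (fst p) + g (snd p)" "arcs E"]
    by (simp add: P_def energy_def case_prod_beta)
  finally have 1: "4 * (conductance E * Q)\<^sup>2 \<le> 2 * energy E g * P"
    by (simp add: power_mult_distrib)
  have "P + 2 * energy E g = (\<Sum>(u, v)\<in>arcs E. 2 * (g u)\<^sup>2) + (\<Sum>(u, v)\<in>arcs E. 2 * (g v)\<^sup>2)"
    by (simp add: P_def energy_def sum.distrib[symmetric] case_prod_beta power2_sum power2_diff algebra_simps)
  also have "\<dots> = 4 * (\<Sum>u\<in>UNIV. real (degree_of E u) * (g u)\<^sup>2)"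
    by (simp only: sum_arcs_tail sum_arcs_head) (simp add: sum_distrib_left mult_ac)
  also have "\<dots> \<le> 4 * (\<Sum>u\<in>UNIV. real (max_degree E) * (g u)\<^sup>2)"
    by (intro mult_left_mono sum_mono mult_right_mono) (auto simp: max_degree_def)
  finally have "P \<le> 4 * (real (max_degree E) * Q) - 2 * energy E g"
    by (simp add: Q_def sum_distrib_left)
  then have "2 * energy E g * P \<le> 2 * energy E g * (4 * (real (max_degree E) * Q) - 2 * energy E g)"
    by (intro mult_left_mono) (auto simp: energy_nonneg)
  with 1 show ?thesis
    by (simp add: algebra_simps)
qed

text \<open>
  The left-hand side of the product inequality is positive, so the energy is too, and dropping the
  square of the energy on the right-hand side makes the inequality strict.
\<close>

lemma energy_lower_bound_small_support:
  fixes g :: "'v::finite \<Rightarrow> real" and E :: "'v set set"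
  assumes nn: "\<And>u. 0 \<le> g u" and supp: "real (card {u. g u \<noteq> 0}) \<le> real CARD('v) / 2"
    and h: "0 < conductance E" and nz: "g w \<noteq> 0"
  shows "(conductance E)\<^sup>2 / (2 * real (max_degree E)) * (\<Sum>u\<in>UNIV. (g u)\<^sup>2) < energy E g"
proof -
  define Q where "Q = (\<Sum>u\<in>UNIV. (g u)\<^sup>2)"
  define d where "d = real (max_degree E)"
  define e where "e = energy E g"
  have Q: "0 < Q"
    unfolding Q_def using nz by (intro sum_pos2[of _ w]) auto
  have main: "(conductance E * Q)\<^sup>2 \<le> e * (2 * d * Q - e)"
    unfolding Q_def d_def e_def using assms by (intro cheeger_product_inequality) auto
  have "0 < (conductance E * Q)\<^sup>2"
    using h Q by simp
  then have e: "0 < e"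
    using main energy_nonneg[of E g] by (metis e_def mult_zero_left not_le order_le_less)
  have "(conductance E * Q)\<^sup>2 < e * (2 * d * Q)"
    using main e by (smt (verit) mult_pos_pos right_diff_distrib)
  then have lt: "(conductance E)\<^sup>2 * Q < e * (2 * d)"
    using Q by (simp add: power_mult_distrib power2_eq_square mult_ac)
  have "0 \<le> (conductance E)\<^sup>2 * Q"
    using Q by simp
  with lt e have "0 < d"
    by (smt (verit) zero_less_mult_pos)
  then show ?thesis
    using lt by (simp add: Q_def d_def e_def field_simps)
qed

text \<open>
  Take for \<open>c\<close> the least value with at most half of the vertices strictly above it. If there are
  values below \<open>c\<close> and \<open>w\<close> is the largest of them, more than half of the vertices lie above \<open>w\<close>, and
  these are the ones not below \<open>c\<close>.
\<close>

lemma median_exists: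
  fixes x :: "'v::finite \<Rightarrow> real"
  obtains c where "real (card {u. x u > c}) \<le> real CARD('v) / 2"
    "real (card {u. x u < c}) \<le> real CARD('v) / 2"
proof -
  define V where "V = {c \<in> range x. 2 * card {u. x u > c} \<le> CARD('v)}"
  have fin: "finite V"
    by (simp add: V_def)
  have "{u. x u > Max (range x)} = {}"
    by (auto simp: not_less)
  then have "card {u. x u > Max (range x)} = 0"
    by (simp only: card.empty)
  moreover have "Max (range x) \<in> range x"
    by (rule Max_in) auto
  ultimately have "Max (range x) \<in> V"
    by (simp add: V_def del: Max_less_iff)
  then have c: "Min V \<in> V"
    using fin by (intro Min_in) auto
  define L where "L = {u. x u < Min V}"
  have "2 * card L \<le> CARD('v)"
  proof (cases "L = {}")
    case False
    define w where "w = Max (x ` L)"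
    have "w \<in> x ` L"
      unfolding w_def using False by (intro Max_in) auto
    then have w: "w \<in> range x" "w < Min V"
      by (auto simp: L_def)
    then have "w \<notin> V"
      using Min_le[OF fin, of w] by linarith
    then have big: "CARD('v) < 2 * card {u. x u > w}"
      using w(1) by (simp add: V_def)
    have "{u. x u > w} = - L"
    proof (intro set_eqI iffI)
      fix u assume "u \<in> {u. x u > w}"
      then show "u \<in> - L"
        unfolding w_def by (auto simp: not_le[symmetric])
    next
      fix u assume "u \<in> - L"
      then show "u \<in> {u. x u > w}"
        using w(2) by (auto simp: L_def)
    qed
    moreover have "card L + card (- L) = CARD('v)"
      using card_Un_disjoint[of L "- L"] by (simp add: Compl_partition)
    ultimately show ?thesis
      using big by simp
  qed simp
  then show ?thesis
    using c that[of "Min V"] by (simp add: V_def L_def)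
qed

text \<open>Only edges with endpoints of opposite sign lose energy, namely the cross term \<open>- 2 a b \<ge> 0\<close>.\<close>

lemma energy_positive_negative_parts:
  "energy E (\<lambda>u. max (x u) 0) + energy E (\<lambda>u. max (- x u) 0) \<le> energy E x"
proof -
  have "(max a 0 - max b 0)\<^sup>2 + (max (- a) 0 - max (- b) 0)\<^sup>2 \<le> (a - b)\<^sup>2" for a b :: real
  proof -
    consider "0 \<le> a" "0 \<le> b" | "a \<le> 0" "b \<le> 0" | "0 \<le> a" "b \<le> 0" | "a \<le> 0" "0 \<le> b"
      by linarith
    then show ?thesis
    proof cases
      case 3
      then show ?thesis
        using mult_nonneg_nonpos[of a b] by (simp add: max_def power2_diff)
    next
      case 4
      then show ?thesis
        using mult_nonpos_nonneg[of a b] by (simp add: max_def power2_diff)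
    qed (auto simp: max_def power2_commute)
  qed
  then show ?thesis
    unfolding energy_def
    by (simp add: add_divide_distrib[symmetric] sum.distrib[symmetric] case_prod_beta divide_right_mono sum_mono)
qed

text \<open>
  Since \<open>x\<close> is orthogonal to the constants, shifting it by a constant \<open>c\<close> adds \<open>n c\<^sup>2\<close> to its squared
  norm, while the energy only sees differences. So \<open>x\<close> may be shifted to have median zero, and its
  positive and negative parts can be treated separately; at least one of them is nonzero.
\<close>

theorem cheeger_inequality:
  fixes x :: "'v::finite \<Rightarrow> real" and E :: "'v set set"
  assumes h: "0 < conductance E" and mean: "(\<Sum>u\<in>UNIV. x u) = 0" and nz: "x w \<noteq> 0"
  shows "(conductance E)\<^sup>2 / (2 * real (max_degree E)) * (\<Sum>u\<in>UNIV. (x u)\<^sup>2) < energy E x"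
proof -
  define k where "k = (conductance E)\<^sup>2 / (2 * real (max_degree E))"
  have k: "0 \<le> k"
    by (simp add: k_def)
  obtain c where c: "real (card {u. x u > c}) \<le> real CARD('v) / 2"
    "real (card {u. x u < c}) \<le> real CARD('v) / 2"
    using median_exists[of x] by blast
  define y where "y u = x u - c" for u
  define p where "p u = max (y u) 0" for u
  define q where "q u = max (- y u) 0" for u
  have supp: "{u. p u \<noteq> 0} = {u. x u > c}" "{u. q u \<noteq> 0} = {u. x u < c}"
    by (auto simp: p_def q_def y_def max_def)
  have weak: "k * (\<Sum>u\<in>UNIV. (g u)\<^sup>2) \<le> energy E g" and strict: "(\<exists>u. g u \<noteq> 0) \<Longrightarrow> k * (\<Sum>u\<in>UNIV. (g u)\<^sup>2) < energy E g"
    if "g = p \<or> g = q" for g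
  proof -
    have g: "0 \<le> g u" "real (card {u. g u \<noteq> 0}) \<le> real CARD('v) / 2" for u
      using that c by (auto simp: supp) (auto simp: p_def q_def)
    show s: "k * (\<Sum>u\<in>UNIV. (g u)\<^sup>2) < energy E g" if "\<exists>u. g u \<noteq> 0"
      using that energy_lower_bound_small_support[OF g h] by (auto simp: k_def)
    show "k * (\<Sum>u\<in>UNIV. (g u)\<^sup>2) \<le> energy E g"
      using s energy_nonneg[of E g] by (cases "\<exists>u. g u \<noteq> 0") auto
  qed
  have "\<exists>u. y u \<noteq> 0"
  proof (rule ccontr)
    assume "\<not> ?thesis"
    then have xc: "x u = c" for u
      by (simp add: y_def)
    then show False
      using mean nz by simp
  qed
  then have "(\<exists>u. p u \<noteq> 0) \<or> (\<exists>u. q u \<noteq> 0)"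
    by (auto simp: p_def q_def max_def) (metis less_eq_real_def not_le neg_0_less_iff_less)
  then have *: "k * (\<Sum>u\<in>UNIV. (p u)\<^sup>2) + k * (\<Sum>u\<in>UNIV. (q u)\<^sup>2) < energy E p + energy E q"
    using weak[of p] weak[of q] strict[of p] strict[of q] by force
  have "(\<Sum>u\<in>UNIV. (y u)\<^sup>2) = (\<Sum>u\<in>UNIV. (x u)\<^sup>2) + real CARD('v) * c\<^sup>2 - 2 * c * (\<Sum>u\<in>UNIV. x u)"
    by (simp add: y_def power2_diff sum.distrib sum_subtractf sum_distrib_left sum_distrib_right mult_ac)
  then have "k * (\<Sum>u\<in>UNIV. (x u)\<^sup>2) \<le> k * (\<Sum>u\<in>UNIV. (y u)\<^sup>2)"
    using k mean by (intro mult_left_mono) auto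
  also have "(\<Sum>u\<in>UNIV. (y u)\<^sup>2) = (\<Sum>u\<in>UNIV. (p u)\<^sup>2) + (\<Sum>u\<in>UNIV. (q u)\<^sup>2)"
    by (subst sum.distrib[symmetric], rule sum.cong) (auto simp: p_def q_def max_def)
  also have "k * \<dots> < energy E p + energy E q"
    using * by (simp add: distrib_left)
  also have "\<dots> \<le> energy E y"
    unfolding p_def q_def by (rule energy_positive_negative_parts)
  also have "energy E y = energy E x"
    by (simp add: energy_def y_def)
  finally show ?thesis
    by (simp add: k_def)
qed

section \<open>Cheeger bounds for the transmission matrix\<close>

theorem eigval_2_A_trs_lower_bound:
  fixes E :: "'v::finite set set"
  assumes conn: "graph_connected E" and card: "CARD('v) \<ge> 2"
    and m: "\<And>u. m \<le> real (transmission E u) - real (degree_of E u)"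
  shows "(conductance E)\<^sup>2 / (2 * real (max_degree E)) + m < eigval 2 (A_trs E)"
proof -
  let ?k = "(conductance E)\<^sup>2 / (2 * real (max_degree E))"
  obtain x where x: "x \<noteq> 0" "(\<Sum>u\<in>UNIV. x $ u) = 0"
    and le: "x \<bullet> (A_trs E *v x) \<le> eigval 2 (A_trs E) * (x \<bullet> x)"
    using eigval_2_witness_sum_zero[OF transpose_A_trs card] by blast
  obtain w where w: "x $ w \<noteq> 0"
    using x(1) by (auto simp: vec_eq_iff)
  have xx: "x \<bullet> x = (\<Sum>u\<in>UNIV. (x $ u)\<^sup>2)"
    by (simp add: inner_vec_def power2_eq_square)
  have "m * (x \<bullet> x) \<le> (\<Sum>u\<in>UNIV. (real (transmission E u) - real (degree_of E u)) * (x $ u)\<^sup>2)"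
    unfolding xx sum_distrib_left using m by (intro sum_mono mult_right_mono) auto
  moreover have "?k * (x \<bullet> x) < energy E (vec_nth x)"
    unfolding xx by (rule cheeger_inequality[OF conductance_pos[OF conn card] x(2) w])
  ultimately have "(?k + m) * (x \<bullet> x) < x \<bullet> (A_trs E *v x)"
    unfolding A_trs_quadratic_form by (simp add: distrib_right)
  also note le
  finally show ?thesis
    by (rule mult_right_less_imp_less) simp
qed

theorem eigval_2_A_trs_upper_bound:
  fixes E :: "'v::finite set set"
  assumes card: "CARD('v) \<ge> 2"
    and m: "\<And>u. real (transmission E u) - real (degree_of E u) \<le> m"
  shows "eigval 2 (A_trs E) \<le> 2 * conductance E + m"
proof -
  obtain S where S: "S \<noteq> {}" "real (card S) \<le> real CARD('v) / 2"
    "real (card (edge_boundary E S)) = conductance E * real (card S)"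
    using conductance_attained[OF card] by blast
  obtain p q where pq: "p \<noteq> 0 \<or> q \<noteq> 0"
    and le': "let x = (\<chi> u. if u \<in> S then p else q) in
      eigval 2 (A_trs E) * (x \<bullet> x) \<le> x \<bullet> (A_trs E *v x)"
    using eigval_2_witness_two_valued[OF transpose_A_trs card, of S E] by blast
  define x where "x = (\<chi> u. if u \<in> S then p else q)"
  have le: "eigval 2 (A_trs E) * (x \<bullet> x) \<le> x \<bullet> (A_trs E *v x)"
    using le' by (simp add: x_def Let_def)
  have xx: "x \<bullet> x = (\<Sum>u\<in>UNIV. (x $ u)\<^sup>2)"
    by (simp add: inner_vec_def power2_eq_square)
  have "real (card S) + real (card (- S)) = real CARD('v)"
    using card_Un_disjoint[of S "- S"] by (simp add: Compl_partition)
  then have compl: "real (card S) \<le> real (card (- S))"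
    using S(2) by linarith
  have norm: "x \<bullet> x = real (card S) * p\<^sup>2 + real (card (- S)) * q\<^sup>2"
    by (simp only: xx) (simp add: x_def if_distrib[of "\<lambda>c. c\<^sup>2"] sum.If_cases Compl_eq cong: if_cong)
  have cond: "0 \<le> conductance E"
    using S by (metis card_gt_0_iff finite of_nat_0_le_iff of_nat_0_less_iff zero_le_mult_iff not_le)
  have "vec_nth x = (\<lambda>u. if u \<in> S then p else q)"
    by (auto simp: x_def)
  then have "energy E (vec_nth x) = conductance E * (real (card S) * (p - q)\<^sup>2)"
    using energy_two_valued[of E S p q] S(3) by simp
  also have "\<dots> \<le> conductance E * (2 * (x \<bullet> x))"
  proof (intro mult_left_mono cond)
    have "(p - q)\<^sup>2 \<le> 2 * (p\<^sup>2 + q\<^sup>2)"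
      using zero_le_power2[of "p + q"] by (simp add: power2_sum power2_diff)
    then have "real (card S) * (p - q)\<^sup>2 \<le> real (card S) * (2 * (p\<^sup>2 + q\<^sup>2))"
      by (rule mult_left_mono) simp
    also have "\<dots> \<le> 2 * (x \<bullet> x)"
      using mult_right_mono[OF compl, of "q\<^sup>2"] by (simp add: norm algebra_simps)
    finally show "real (card S) * (p - q)\<^sup>2 \<le> 2 * (x \<bullet> x)" .
  qed
  finally have "energy E (vec_nth x) \<le> 2 * conductance E * (x \<bullet> x)"
    by simp
  moreover have "(\<Sum>u\<in>UNIV. (real (transmission E u) - real (degree_of E u)) * (x $ u)\<^sup>2) \<le> m * (x \<bullet> x)"
    unfolding xx sum_distrib_left using m by (intro sum_mono mult_right_mono) auto
  ultimately have "x \<bullet> (A_trs E *v x) \<le> (2 * conductance E + m) * (x \<bullet> x)"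
    unfolding A_trs_quadratic_form by (simp add: distrib_right)
  with le have "eigval 2 (A_trs E) * (x \<bullet> x) \<le> (2 * conductance E + m) * (x \<bullet> x)"
    by (rule order_trans)
  moreover have "0 < x \<bullet> x"
  proof -
    have "0 < card S"
      using S(1) by (simp add: card_gt_0_iff)
    then have "0 < real (card S)" "0 < real (card (- S))"
      using compl by auto
    then show ?thesis
      unfolding norm using pq by (smt (verit) mult_nonneg_nonneg mult_pos_pos zero_le_power2 zero_less_power2)
  qed
  ultimately show ?thesis
    by (simp add: mult_le_cancel_right)
qed

theorem theorem4p8:
  fixes E :: "'v::finite set set"
  assumes "simple_graph E" and "graph_connected E" and "CARD('v) \<ge> 2"
  shows "(conductance E)\<^sup>2 / (2 * real (max_degree E))
           + Min {real (transmission E u) - real (degree_of E u) | u. u \<in> UNIV}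
         < eigval 2 (A_trs E)
       \<and> eigval 2 (A_trs E)
         \<le> 2 * conductance E
           + Max {real (transmission E u) - real (degree_of E u) | u. u \<in> UNIV}"
proof (intro conjI eigval_2_A_trs_lower_bound eigval_2_A_trs_upper_bound assms)
  have fin: "finite {real (transmission E u) - real (degree_of E u) | u. u \<in> UNIV}"
    by (simp add: full_SetCompr_eq)
  fix u
  show "Min {real (transmission E u) - real (degree_of E u) | u. u \<in> UNIV}
      \<le> real (transmission E u) - real (degree_of E u)"
    by (rule Min_le[OF fin]) blast
  show "real (transmission E u) - real (degree_of E u)
      \<le> Max {real (transmission E u) - real (degree_of E u) | u. u \<in> UNIV}"
    by (rule Max_ge[OF fin]) blast
qed

end
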